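(* Let $n,m\ge 1$, $C\in\mathbb{S}^n$, $\alpha>0$, $b\in\mathbb{R}^m$, and let $\mathcal{B}:\mathbb{S}^n\to\mathbb{R}^m$ be a linear mapping whose adjoint $\mathcal{B}^*$ is injective. Consider the semidefinite program $$\min\left\{\langle C,X\rangle:\ \mathcal{B}(X)=b,\ X\succeq 0,\ \alpha I\succeq X\right\}.\qquad (\ast)$$ Suppose $(\ast)$ has a feasible solution and let $$\beta:=\max\left\{\mathrm{Tr}(X):\ \mathcal{B}(X)=b,\ \alpha I\succeq X\succeq 0\right\}.$$ Then $(\ast)$ has an optimal solution $X$ such that $\mathrm{rank}(X)\le \left\lceil \frac{\beta}{\alpha}\right\rceil+\sqrt{2m}-1$.
   Context: $\mathbb{S}^n$ is the space of real symmetric $n\times n$ matrices with inner product $\langle A,B\rangle=\mathrm{Tr}(AB)$; $X\succeq 0$ means $X$ is positive semidefinite and $\alpha I\succeq X$ means $\alpha I-X\succeq 0$. *)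

theory Defs
  imports "HOL-Analysis.Analysis"
begin

text \<open>
  The space of real symmetric \<open>n \<times> n\<close> matrices is a type of its own, so that \<^const>\<open>linear\<close> and
  \<^const>\<open>adjoint\<close> refer to maps on symmetric matrices only, and the adjoint is taken with respect
  to the trace inner product. The size \<open>n \<ge> 1\<close> is \<open>CARD('n)\<close>.
\<close>

typedef 'n symmat = "{A :: real^'n^'n. transpose A = A}"
  morphisms mat_of Symmat
  by (rule exI[of _ 0]) (simp add: transpose_def vec_eq_iff)

setup_lifting type_definition_symmat

instantiation symmat :: (finite) real_vector
begin

lift_definition zero_symmat :: "'a symmat" is 0
  by (simp add: transpose_def vec_eq_iff)

lift_definition plus_symmat :: "'a symmat \<Rightarrow> 'a symmat \<Rightarrow> 'a symmat" is "(+)"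
  by (simp add: transpose_def vec_eq_iff)

lift_definition minus_symmat :: "'a symmat \<Rightarrow> 'a symmat \<Rightarrow> 'a symmat" is "(-)"
  by (simp add: transpose_def vec_eq_iff)

lift_definition uminus_symmat :: "'a symmat \<Rightarrow> 'a symmat" is uminus
  by (simp add: transpose_def vec_eq_iff)

lift_definition scaleR_symmat :: "real \<Rightarrow> 'a symmat \<Rightarrow> 'a symmat" is "(*\<^sub>R)"
  by (simp add: transpose_def vec_eq_iff)

instance
  by standard (transfer; simp add: algebra_simps)+

end

lemma trace_mult_symmat:
  "trace (mat_of X ** mat_of Y) = inner (mat_of X) (mat_of Y)"
proof -
  have "mat_of Y $ k $ i = mat_of Y $ i $ k" for i k
    using mat_of[of Y] by (auto simp: transpose_def vec_eq_iff)
  then show ?thesis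
    by (simp add: trace_def matrix_matrix_mult_def inner_vec_def)
qed

instantiation symmat :: (finite) real_inner
begin

definition inner_symmat :: "'a symmat \<Rightarrow> 'a symmat \<Rightarrow> real" where
  "inner X Y = trace (mat_of X ** mat_of Y)"

definition norm_symmat :: "'a symmat \<Rightarrow> real" where
  "norm_symmat X = sqrt (inner X X)"

definition sgn_symmat :: "'a symmat \<Rightarrow> 'a symmat" where
  "sgn_symmat X = inverse (norm X) *\<^sub>R X"

definition dist_symmat :: "'a symmat \<Rightarrow> 'a symmat \<Rightarrow> real" where
  "dist_symmat X Y = norm (X - Y)"

definition uniformity_symmat :: "('a symmat \<times> 'a symmat) filter" where
  "uniformity_symmat = (INF e\<in>{0 <..}. principal {(X, Y). dist X Y < e})"

definition open_symmat :: "'a symmat set \<Rightarrow> bool" where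
  "open_symmat U \<longleftrightarrow> (\<forall>X\<in>U. \<forall>\<^sub>F (X', Y) in uniformity. X' = X \<longrightarrow> Y \<in> U)"

instance
proof
  have inner_eq: "inner X Y = inner (mat_of X) (mat_of Y)" for X Y :: "'a symmat"
    by (simp add: inner_symmat_def trace_mult_symmat)
  fix X Y Z :: "'a symmat" and r :: real
  show "inner X Y = inner Y X"
    by (simp add: inner_eq inner_commute)
  show "inner (X + Y) Z = inner X Z + inner Y Z"
    by (simp add: inner_eq plus_symmat.rep_eq inner_add_left)
  show "inner (r *\<^sub>R X) Y = r * inner X Y"
    by (simp add: inner_eq scaleR_symmat.rep_eq)
  show "0 \<le> inner X X"
    by (simp add: inner_eq)
  show "inner X X = 0 \<longleftrightarrow> X = 0"
    by (simp add: inner_eq zero_symmat.rep_eq flip: mat_of_inject)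
qed (simp_all add: norm_symmat_def sgn_symmat_def dist_symmat_def uniformity_symmat_def
       open_symmat_def)

end

lemma inner_symmat_eq: "inner X Y = inner (mat_of X) (mat_of Y)"
  by (simp add: inner_symmat_def trace_mult_symmat)

lemma linear_mat_of: "linear mat_of"
  by (rule linearI) (simp_all add: plus_symmat.rep_eq scaleR_symmat.rep_eq)

lemma symmat_orthonormal_basis:
  "\<exists>S :: ('n::finite) symmat set. finite S \<and> S \<noteq> {} \<and>
     (\<forall>u\<in>S. \<forall>v\<in>S. inner u v = (if u = v then 1 else 0)) \<and>
     (\<forall>X. (\<forall>u\<in>S. inner X u = 0) \<longleftrightarrow> X = 0)"
proof -
  let ?R = "range (mat_of :: 'n symmat \<Rightarrow> _)"
  have sub: "subspace ?R"
    using linear_subspace_image[OF linear_mat_of subspace_UNIV] .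
  obtain T where T: "T \<subseteq> ?R" "pairwise orthogonal T" "\<And>x. x \<in> T \<Longrightarrow> norm x = 1"
      "independent T" "span T = ?R"
    using orthonormal_basis_subspace[OF sub] by metis
  let ?S = "mat_of -` T :: 'n symmat set"
  have fin: "finite ?S"
    using T(4) by (intro finite_vimageI)
      (auto simp: independent_imp_finite inj_on_def mat_of_inject)
  have orth: "inner u v = (if u = v then 1 else 0)" if "u \<in> ?S" "v \<in> ?S" for u v
    using that T(2) T(3)[of "mat_of u"]
    by (auto simp: inner_symmat_eq pairwise_def orthogonal_def mat_of_inject norm_eq_1)
  have zero: "X = 0" if X: "\<forall>u\<in>?S. inner X u = 0" for X
  proof -
    have "orthogonal (mat_of X) y" if "y \<in> T" for y
      using X that T(1) by (auto simp: inner_symmat_eq orthogonal_def)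
    then have "orthogonal (mat_of X) (mat_of X)"
      using orthogonal_to_span[of "mat_of X" T "mat_of X"] T(5) by auto
    then show ?thesis
      by (simp add: orthogonal_self zero_symmat.rep_eq flip: mat_of_inject)
  qed
  have "transpose (mat 1 :: real^'n^'n) = mat 1"
    by (simp add: transpose_mat)
  then obtain I :: "'n symmat" where "mat_of I = mat 1"
    using Symmat_inverse[of "mat 1"] by blast
  then have "mat_of I $ i $ i \<noteq> 0" for i
    by (simp add: mat_def)
  then have "I \<noteq> 0"
    by (auto simp: zero_symmat.rep_eq)
  then have "?S \<noteq> {}"
    using zero[of I] by auto
  with fin orth zero show ?thesis
    by (intro exI[of _ ?S]) auto
qed

instantiation symmat :: (finite) euclidean_space
begin

definition Basis_symmat :: "'a symmat set" where
  "Basis_symmat = (SOME S. finite S \<and> S \<noteq> {} \<and>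
     (\<forall>u\<in>S. \<forall>v\<in>S. inner u v = (if u = v then 1 else 0)) \<and>
     (\<forall>X. (\<forall>u\<in>S. inner X u = 0) \<longleftrightarrow> X = 0))"

instance
proof -
  note * = someI_ex[OF symmat_orthonormal_basis[where 'n = 'a], folded Basis_symmat_def]
  show "OFCLASS('a symmat, euclidean_space_class)"
    by standard (use * in auto)
qed

end

lift_definition id_symmat :: "('n::finite) symmat" is "mat 1"
  by (simp add: transpose_mat)

definition psd :: "('n::finite) symmat \<Rightarrow> bool" where
  "psd X \<longleftrightarrow> (\<forall>v. 0 \<le> inner v (mat_of X *v v))"

definition sdp_feasible ::
    "(('n::finite) symmat \<Rightarrow> real^('m::finite)) \<Rightarrow> real^'m \<Rightarrow> real \<Rightarrow> 'n symmat \<Rightarrow> bool" where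
  "sdp_feasible B b \<alpha> X \<longleftrightarrow> B X = b \<and> psd X \<and> psd (\<alpha> *\<^sub>R id_symmat - X)"

end

theory Submission
  imports Defs
begin

text \<open>
  The feasible set is compact and convex, so the minimum is attained at an extreme point \<open>X\<close> of it
  (\<open>extreme_minimizer_exists\<close>). The eigenvalues of \<open>X\<close> lie in \<open>[0, \<alpha>]\<close>. Let \<open>k\<close> be the multiplicity of
  the eigenvalue \<open>\<alpha>\<close> and \<open>r\<close> the number of eigenvalues strictly between \<open>0\<close> and \<open>\<alpha>\<close>, so that
  the rank is \<open>k + r\<close>. The two summands are controlled by different constraints.

  The number \<open>r\<close> is limited by the linear equations: \<open>X\<close> can be perturbed freely inside the span of
  the \<open>r\<close> intermediate eigenvectors without leaving the matrix interval, and there are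
  \<open>r (r + 1) / 2\<close> independent such perturbations. Extremality forbids \<open>B\<close> to
  annihilate a nonzero combination of them, so \<open>r (r + 1) \<le> 2 m\<close> and \<open>r \<le> sqrt (2 m)\<close>
  (\<open>extreme_point_dim_bound\<close>).

  The number \<open>k\<close> is limited by the trace: \<open>k \<alpha> \<le> Tr X \<le> \<beta>\<close>, with strict inequality on the left if \<open>r > 0\<close>
  (\<open>eigenspace_trace_bound\<close>). If \<open>r > 0\<close>, this gives \<open>k \<le> \<lceil>\<beta> / \<alpha>\<rceil> - 1\<close>; if \<open>r = 0\<close>, it gives
  \<open>k \<le> \<lceil>\<beta> / \<alpha>\<rceil>\<close>, and \<open>sqrt (2 m) \<ge> 1\<close>.

  A diagonalization of \<open>X\<close> is avoided. Only the kernels \<open>U\<close> of \<open>X\<close> and \<open>W\<close> of \<open>\<alpha> I - X\<close> occur,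
  together with the orthogonal complement \<open>V\<close> of \<open>U \<union> W\<close>, which stands for the span of the
  intermediate eigenvectors; \<open>k\<close> and \<open>r\<close> are the dimensions of \<open>W\<close> and \<open>V\<close>, and
  the rank is at most their sum (\<open>rank_le_dim_plus_complement\<close>).
\<close>

section \<open>Quadratic forms of symmetric matrices\<close>

lemma transpose_mat_of [simp]: "transpose (mat_of X) = mat_of X"
  using mat_of[of X] by simp

lemma inner_mat_of_commute: "inner x (mat_of X *v y) = inner (mat_of X *v x) y"
proof -
  have "inner x (mat_of X *v y) = inner (x v* mat_of X) y"
    by (simp add: dot_lmul_matrix)
  also have "x v* mat_of X = transpose (mat_of X) *v x"
    by (metis transpose_matrix_vector)
  finally show ?thesis
    by (simp del: transpose_matrix_vector)
qed

lemma mat_of_add_vec: "mat_of (X + Y) *v x = mat_of X *v x + mat_of Y *v x"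
  by (simp add: plus_symmat.rep_eq matrix_vector_mult_add_rdistrib)

lemma mat_of_diff_vec: "mat_of (X - Y) *v x = mat_of X *v x - mat_of Y *v x"
  by (simp add: minus_symmat.rep_eq matrix_vector_mult_diff_rdistrib)

lemma mat_of_scaleR_vec: "mat_of (c *\<^sub>R X) *v x = c *\<^sub>R (mat_of X *v x)"
  by (simp add: scaleR_symmat.rep_eq scaleR_matrix_vector_assoc)

lemma mat_of_id_vec: "mat_of id_symmat *v x = x"
  by (simp add: id_symmat.rep_eq)

lemmas mat_of_vec_simps =
  mat_of_add_vec mat_of_diff_vec mat_of_scaleR_vec mat_of_id_vec

lemma psd_add: "psd X \<Longrightarrow> psd Y \<Longrightarrow> psd (X + Y)"
  by (simp add: psd_def mat_of_vec_simps inner_add_right)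

lemma psd_scaleR: "psd X \<Longrightarrow> 0 \<le> c \<Longrightarrow> psd (c *\<^sub>R X)"
  by (simp add: psd_def mat_of_vec_simps)

text \<open>
  If the quadratic form vanishes at \<open>x\<close> but \<open>y = X x\<close> is nonzero, then a small step from \<open>x\<close> in
  direction \<open>-y\<close> makes the form negative: its first-order change is \<open>-2 t \<langle>y, y\<rangle>\<close>, and the
  second-order term is of size \<open>t\<^sup>2\<close>.
\<close>

lemma psd_kernel:
  assumes "psd X" and "inner x (mat_of X *v x) = 0"
  shows "mat_of X *v x = 0"
proof (rule ccontr)
  assume nz: "mat_of X *v x \<noteq> 0"
  define y where "y = mat_of X *v x"
  define q where "q = inner y (mat_of X *v y)"
  \<comment> \<open>The step would be optimal with \<open>q\<close> in the denominator; adding \<open>1\<close> keeps it positive if \<open>q = 0\<close>.\<close>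
  define t where "t = inner y y / (q + 1)"
  have q: "0 \<le> q"
    using assms(1) by (simp add: psd_def q_def)
  have y: "0 < inner y y"
    using nz by (simp add: y_def)
  have t: "0 < t" "t * (q + 1) = inner y y"
    using q y by (auto simp: t_def)
  have "inner (x - t *\<^sub>R y) (mat_of X *v (x - t *\<^sub>R y)) = t * (t * q) - 2 * (t * inner y y)"
    using assms(2) inner_mat_of_commute[of x X y]
    by (simp add: matrix_vector_mult_diff_distrib matrix_vector_mult_scaleR inner_diff_left
        inner_diff_right q_def y_def[symmetric] algebra_simps)
  also have "\<dots> = - (t * t * (q + 2))"
    unfolding t(2)[symmetric] by (simp add: algebra_simps)
  also have "\<dots> < 0"
    using t(1) q by (simp add: mult_pos_pos)
  finally show False
    using assms(1) by (simp add: psd_def not_le[symmetric])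
qed

text \<open>
  On the unit sphere of \<open>V\<close> the form attains its minimum, which is positive because a zero of the
  form lies in the kernel. This compactness argument supplies what the smallest eigenvalue of \<open>X\<close>
  on \<open>V\<close> would give.
\<close>

lemma psd_bounded_below:
  assumes "psd X" and "subspace V" and "\<And>v. v \<in> V \<Longrightarrow> mat_of X *v v = 0 \<Longrightarrow> v = 0"
  shows "\<exists>e>0. \<forall>v\<in>V. e * (norm v)\<^sup>2 \<le> inner v (mat_of X *v v)"
proof (cases "V \<inter> sphere 0 1 = {}")
  case True
  have "v = 0" if "v \<in> V" for v
  proof (rule ccontr)
    assume "v \<noteq> 0"
    then have "v /\<^sub>R norm v \<in> V \<inter> sphere 0 1"
      using that assms(2) by (simp add: subspace_scale)
    with True show False
      by blast
  qed
  then show ?thesis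
    by (intro exI[of _ 1]) fastforce
next
  case False
  have "compact (V \<inter> sphere 0 1)"
    using assms(2) by (intro closed_Int_compact closed_subspace) auto
  moreover have "continuous_on (V \<inter> sphere 0 1) (\<lambda>v. inner v (mat_of X *v v))"
    by (intro continuous_intros linear_continuous_on) auto
  ultimately obtain u where u: "u \<in> V" "norm u = 1"
    and least: "\<And>v. v \<in> V \<Longrightarrow> norm v = 1 \<Longrightarrow> inner u (mat_of X *v u) \<le> inner v (mat_of X *v v)"
    using continuous_attains_inf[OF _ False] by fastforce
  define e where "e = inner u (mat_of X *v u)"
  have "e \<noteq> 0"
    using psd_kernel[OF assms(1), of u] assms(3)[OF u(1)] u(2) unfolding e_def by force
  then have "e > 0"
    using assms(1) by (simp add: psd_def e_def order.strict_iff_order)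
  moreover have "e * (norm v)\<^sup>2 \<le> inner v (mat_of X *v v)" if "v \<in> V" for v
  proof (cases "v = 0")
    case False
    have "e \<le> inner (v /\<^sub>R norm v) (mat_of X *v (v /\<^sub>R norm v))"
      unfolding e_def using that False assms(2) by (intro least) (auto simp: subspace_scale)
    then show ?thesis
      using False by (simp add: matrix_vector_mult_scaleR field_simps power2_eq_square)
  qed simp
  ultimately show ?thesis
    by blast
qed

text \<open>
  Since both matrices annihilate the kernel of \<open>X\<close>, their forms see only the component of a vector
  orthogonal to that kernel. There \<open>X\<close> is uniformly positive definite, and this absorbs any small
  multiple of \<open>D\<close>. The bound is stated for both signs of \<open>s\<close> so that \<open>X\<close> becomes the midpoint of a
  segment of positive semidefinite matrices.
\<close>

lemma psd_perturbation:
  assumes "psd X" and ker: "\<And>x. mat_of X *v x = 0 \<Longrightarrow> mat_of D *v x = 0"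
  shows "\<exists>t>0. \<forall>s. \<bar>s\<bar> \<le> t \<longrightarrow> psd (X + s *\<^sub>R D)"
proof -
  define U where "U = {x. mat_of X *v x = 0}"
  define V where "V = {v. \<forall>u\<in>U. orthogonal u v}"
  have sub: "subspace U" "subspace V"
    unfolding U_def V_def
    by (rule linear_subspace_kernel[OF matrix_vector_mul_linear], rule subspace_orthogonal_to_vectors)
  have "v = 0" if "v \<in> V" "mat_of X *v v = 0" for v
    using that by (auto simp: U_def V_def orthogonal_self)
  from psd_bounded_below[OF assms(1) sub(2) this]
  obtain e where e: "e > 0" "\<And>v. v \<in> V \<Longrightarrow> e * (norm v)\<^sup>2 \<le> inner v (mat_of X *v v)"
    by blast
  obtain K where K: "K > 0" "\<And>v. norm (mat_of D *v v) \<le> K * norm v"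
    using linear_bounded_pos[OF matrix_vector_mul_linear[of "mat_of D"]] by blast
  have "psd (X + s *\<^sub>R D)" if s: "\<bar>s\<bar> \<le> e / K" for s
    unfolding psd_def
  proof
    fix x
    obtain u v where uv: "u \<in> span U" "\<And>w. w \<in> span U \<Longrightarrow> orthogonal v w" "x = u + v"
      using orthogonal_subspace_decomp_exists[of U x] by blast
    have "u \<in> U" "v \<in> V"
      using uv sub(1) by (auto simp: V_def span_eq_iff[THEN iffD2] orthogonal_commute)
    have zero: "mat_of (X + s *\<^sub>R D) *v u = 0"
      using \<open>u \<in> U\<close> ker by (simp add: U_def mat_of_vec_simps)
    then have "inner x (mat_of (X + s *\<^sub>R D) *v x) = inner v (mat_of (X + s *\<^sub>R D) *v v)"
      using inner_mat_of_commute[of u "X + s *\<^sub>R D" v]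
      by (simp add: uv(3) matrix_vector_right_distrib inner_add_left)
    also have "\<dots> = inner v (mat_of X *v v) + s * inner v (mat_of D *v v)"
      by (simp add: mat_of_vec_simps inner_add_right)
    also have "\<dots> \<ge> 0"
    proof -
      have "\<bar>inner v (mat_of D *v v)\<bar> \<le> norm v * norm (mat_of D *v v)"
        by (rule Cauchy_Schwarz_ineq2)
      also have "\<dots> \<le> norm v * (K * norm v)"
        by (intro mult_left_mono K) auto
      finally have "\<bar>s * inner v (mat_of D *v v)\<bar> \<le> (e / K) * (norm v * (K * norm v))"
        unfolding abs_mult using s by (intro mult_mono) auto
      also have "\<dots> = e * (norm v)\<^sup>2"
        using K(1) by (simp add: power2_eq_square)
      finally show ?thesis
        using e(2)[OF \<open>v \<in> V\<close>] by linarith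
    qed
    finally show "0 \<le> inner x (mat_of (X + s *\<^sub>R D) *v x)" .
  qed
  moreover have "e / K > 0"
    using e K by simp
  ultimately show ?thesis
    by blast
qed

section \<open>The feasible set\<close>

lemma linear_quadratic_form: "linear (\<lambda>X. inner v (mat_of X *v v))"
  by (rule linearI) (simp_all add: mat_of_vec_simps inner_add_right)

lemma closed_psd: "closed {X. psd X}"
proof -
  have "closed (\<Inter>v. {X. 0 \<le> inner v (mat_of X *v v)})"
    by (intro closed_INT ballI closed_Collect_le continuous_intros linear_continuous_on
        linear_conv_bounded_linear[THEN iffD1] linear_quadratic_form)
  then show ?thesis
    by (simp add: psd_def Collect_all_eq)
qed

lemma quadratic_form_axis: "inner (axis i a) (mat_of X *v axis j b) = a * b * mat_of X $ i $ j"
  by (simp add: inner_axis_axis inner_axis' matrix_vector_mul_component inner_axis)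

text \<open>
  The diagonal entries lie in \<open>[0, \<alpha>]\<close>, and nonnegativity of the form at \<open>e\<^sub>i + e\<^sub>j\<close> and
  \<open>e\<^sub>i - e\<^sub>j\<close> bounds an entry in absolute value by the mean of two diagonal ones. This is what makes the
  feasible set bounded.
\<close>

lemma box_entry_le:
  assumes "psd X" and "psd (\<alpha> *\<^sub>R id_symmat - X)"
  shows "\<bar>mat_of X $ i $ j\<bar> \<le> \<alpha>"
proof -
  have sym: "mat_of X $ j $ i = mat_of X $ i $ j"
    using transpose_mat_of[of X] by (auto simp: transpose_def vec_eq_iff)
  have diag: "mat_of X $ k $ k \<le> \<alpha>" for k
    using assms(2)[unfolded psd_def, rule_format, of "axis k 1"]
    by (simp add: mat_of_vec_simps inner_diff_right quadratic_form_axis inner_axis_axis)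
  have "0 \<le> mat_of X $ i $ i + 2 * c * mat_of X $ i $ j + c * c * mat_of X $ j $ j" for c
    using assms(1)[unfolded psd_def, rule_format, of "axis i 1 + axis j c"]
    by (simp add: matrix_vector_right_distrib inner_add_left inner_add_right quadratic_form_axis sym)
  from this[of 1] this[of "-1"] diag[of i] diag[of j] show ?thesis
    by simp
qed

lemma norm_mat_of: "norm (mat_of X) = norm X"
  by (simp add: norm_eq_sqrt_inner inner_symmat_eq)

lemma compact_feasible:
  assumes "linear B"
  shows "compact {X. sdp_feasible B b \<alpha> X}"
proof -
  have cont: "continuous_on UNIV B"
    using assms by (simp add: linear_continuous_on linear_linear)
  have "closed ({X. B X = b} \<inter> {X. psd X} \<inter> (\<lambda>X. \<alpha> *\<^sub>R id_symmat - X) -` {X. psd X})"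
    by (intro closed_Int closed_psd closed_vimage closed_Collect_eq cont continuous_intros)
  moreover have "{X. sdp_feasible B b \<alpha> X} =
      {X. B X = b} \<inter> {X. psd X} \<inter> (\<lambda>X. \<alpha> *\<^sub>R id_symmat - X) -` {X. psd X}"
    by (auto simp: sdp_feasible_def)
  moreover have "bounded {X. sdp_feasible B b \<alpha> X}"
  proof (rule boundedI)
    fix X assume "X \<in> {X. sdp_feasible B b \<alpha> X}"
    then have entry: "\<bar>mat_of X $ i $ j\<bar> \<le> \<alpha>" for i j
      by (auto simp: sdp_feasible_def box_entry_le)
    have "norm X \<le> norm ((\<chi> i j. \<alpha>) :: real^'a^'a)"
      unfolding norm_mat_of[symmetric]
      by (intro norm_le_componentwise_cart) (auto intro: order_trans[OF entry])
    then show "norm X \<le> norm ((\<chi> i j. \<alpha>) :: real^'a^'a)" .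
  qed
  ultimately show ?thesis
    by (simp add: compact_eq_bounded_closed)
qed

lemma convex_feasible:
  assumes "linear B"
  shows "convex {X. sdp_feasible B b \<alpha> X}"
proof (rule convexI, clarify)
  fix X Y and u v :: real
  assume X: "sdp_feasible B b \<alpha> X" and Y: "sdp_feasible B b \<alpha> Y"
    and uv: "0 \<le> u" "0 \<le> v" "u + v = 1"
  have "B (u *\<^sub>R X + v *\<^sub>R Y) = (u + v) *\<^sub>R b"
    using X Y assms by (simp add: sdp_feasible_def linear_add linear_scale scaleR_add_left)
  moreover have "\<alpha> *\<^sub>R id_symmat - (u *\<^sub>R X + v *\<^sub>R Y) =
      u *\<^sub>R (\<alpha> *\<^sub>R id_symmat - X) + v *\<^sub>R (\<alpha> *\<^sub>R id_symmat - Y)"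
  proof -
    have "\<alpha> *\<^sub>R id_symmat = (u + v) *\<^sub>R \<alpha> *\<^sub>R (id_symmat :: 'a symmat)"
      by (simp add: uv)
    then show ?thesis
      by (simp add: scaleR_add_left scaleR_diff_right del: scaleR_scaleR)
  qed
  ultimately show "sdp_feasible B b \<alpha> (u *\<^sub>R X + v *\<^sub>R Y)"
    using X Y uv by (simp add: sdp_feasible_def psd_add psd_scaleR)
qed

text \<open>
  The minimizers form a face, and an extreme point of a face is extreme in the whole set.
\<close>

lemma extreme_minimizer_exists:
  fixes S :: "'a::euclidean_space set"
  assumes "compact S" "convex S" "S \<noteq> {}"
  obtains x where "x extreme_point_of S" and "\<And>y. y \<in> S \<Longrightarrow> inner c x \<le> inner c y"
proof -
  obtain z where z: "z \<in> S" "\<And>y. y \<in> S \<Longrightarrow> inner c z \<le> inner c y"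
    using continuous_attains_inf[OF assms(1,3)
        continuous_on_inner[OF continuous_on_const continuous_on_id], of c]
    by blast
  let ?F = "S \<inter> {x. inner c x = inner c z}"
  have face: "?F face_of S"
    using assms(2) z by (intro face_of_Int_supporting_hyperplane_ge) auto
  obtain x where "x extreme_point_of ?F"
  proof (rule extreme_point_exists_convex)
    show "compact ?F" "convex ?F"
      using face assms face_of_imp_compact face_of_imp_convex by blast+
    show "?F \<noteq> {}"
      using z by blast
  qed
  then show thesis
    using that[of x] z(2) by (auto simp: extreme_point_of_face[OF face])
qed

section \<open>Symmetric matrices supported on a subspace\<close>

text \<open>
  The symmetric product \<open>a b\<^sup>T + b a\<^sup>T\<close>; there is no factor \<open>1/2\<close>, so \<open>sym_outer e e\<close> is twice the
  orthogonal projection onto the line of a unit vector \<open>e\<close>.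
\<close>

lift_definition sym_outer :: "real^'n \<Rightarrow> real^'n \<Rightarrow> ('n::finite) symmat" is
  "\<lambda>a b. \<chi> i j. a $ i * b $ j + b $ i * a $ j"
  by (simp add: transpose_def vec_eq_iff mult.commute)

lemma sym_outer_vec:
  "mat_of (sym_outer a b) *v x = inner b x *\<^sub>R a + inner a x *\<^sub>R b"
  by (simp add: sym_outer.rep_eq vec_eq_iff matrix_vector_mult_def inner_vec_def
      sum.distrib sum_distrib_left sum_distrib_right algebra_simps)

lemma inner_sym_outer:
  "inner (sym_outer a b) X = 2 * inner a (mat_of X *v b)"
proof -
  have "inner (sym_outer a b) X = inner a (mat_of X *v b) + inner b (mat_of X *v a)"
    by (simp add: inner_symmat_eq sym_outer.rep_eq inner_vec_def matrix_vector_mult_def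
        sum_distrib_left sum.distrib algebra_simps)
  then show ?thesis
    using inner_mat_of_commute[of b X a] by (simp add: inner_commute)
qed

lemma inner_sym_outer_sym_outer:
  "inner (sym_outer a b) (sym_outer c d) = 2 * (inner a c * inner b d + inner a d * inner b c)"
  by (simp add: inner_sym_outer sym_outer_vec inner_add_right inner_commute algebra_simps)

text \<open>
  The matrices on the right are those acting only inside \<open>V\<close>; they form a copy of the symmetric
  matrices of size \<open>dim V\<close>. For an orthonormal basis \<open>h\<close> of \<open>V\<close>, the symmetric products of \<open>h i\<close> and
  \<open>h j\<close> with \<open>i \<le> j\<close> are nonzero and pairwise orthogonal for the trace inner product, hence
  independent.
\<close>

lemma dim_supported_symmat:
  fixes V :: "(real^'n) set"
  assumes "subspace V"
  shows "dim V * (dim V + 1) \<le>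
    2 * dim {D :: 'n symmat. \<forall>x. (\<forall>v\<in>V. orthogonal v x) \<longrightarrow> mat_of D *v x = 0}"
    (is "_ \<le> 2 * dim ?S")
proof -
  obtain T where T: "T \<subseteq> V" "pairwise orthogonal T" "\<And>x. x \<in> T \<Longrightarrow> norm x = 1"
    "independent T" "card T = dim V"
    using orthonormal_basis_subspace[OF assms] by metis
  define r where "r = dim V"
  obtain h where h: "bij_betw h {..<r} T"
    using T(4,5) independent_imp_finite ex_bij_betw_nat_finite[of T]
    by (metis atLeast0LessThan r_def)
  have h_T: "h i \<in> T" if "i < r" for i
    using h that by (auto simp: bij_betw_def)
  have orth: "inner (h i) (h j) = (if i = j then 1 else 0)" if "i < r" "j < r" for i j
  proof (cases "i = j")
    case True
    then show ?thesis
      using T(3)[OF h_T[OF that(1)]] by (simp add: norm_eq_1)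
  next
    case False
    then have "h i \<noteq> h j"
      using h that by (auto simp: bij_betw_def inj_on_def)
    then show ?thesis
      using T(2) h_T that False by (auto simp: pairwise_def orthogonal_def)
  qed
  \<comment> \<open>Only pairs with \<open>i \<le> j\<close>, as the symmetric product does not depend on the order of its factors.\<close>
  define P where "P = (SIGMA j:{..<r}. {..j})"
  define F where "F = (\<lambda>(j, i). sym_outer (h i) (h j))"
  have F_inner: "inner (F p) (F q) = 0 \<longleftrightarrow> p \<noteq> q" if "p \<in> P" "q \<in> P" for p q
    using that by (auto simp: F_def P_def inner_sym_outer_sym_outer orth split: if_splits)
  have inj: "inj_on F P"
    by (rule inj_onI) (metis F_inner)
  have "independent (F ` P)"
  proof (rule pairwise_orthogonal_independent)
    show "pairwise orthogonal (F ` P)"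
      using F_inner by (auto simp: pairwise_def orthogonal_def)
    show "0 \<notin> F ` P"
      using F_inner by (metis imageE inner_zero_left)
  qed
  moreover have "F ` P \<subseteq> ?S"
  proof -
    have "h i \<in> V" if "i < r" for i
      using h_T[OF that] T(1) by blast
    then show ?thesis
      by (auto simp: F_def P_def sym_outer_vec orthogonal_def)
  qed
  ultimately have "card (F ` P) \<le> dim ?S"
    using independent_card_le_dim by blast
  then have "card P \<le> dim ?S"
    by (simp add: card_image inj)
  moreover have "2 * card P = r * (r + 1)"
  proof -
    have "card P = (\<Sum>j<r. Suc j)"
      by (simp add: P_def)
    also have "2 * \<dots> = r * (r + 1)"
      by (induction r) auto
    finally show ?thesis .
  qed
  ultimately show ?thesis
    by (simp add: r_def[symmetric])
qed

lemma linear_kernel_in_subspace: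
  fixes f :: "'a::euclidean_space \<Rightarrow> 'b::euclidean_space"
  assumes "linear f" and "subspace S" and "DIM('b) < dim S"
  obtains x where "x \<in> S" "x \<noteq> 0" "f x = 0"
proof -
  have "\<not> inj_on f S"
  proof
    assume "inj_on f S"
    then have "dim (f ` S) = dim S"
      using assms(1,2) by (intro dim_image_eq) (simp_all add: span_eq_iff[THEN iffD2])
    then show False
      using assms(3) dim_subset_UNIV[of "f ` S"] by linarith
  qed
  then show thesis
    using linear_inj_on_iff_eq_0[OF assms(1,2)] that by blast
qed

section \<open>Eigenspaces, trace and rank\<close>

text \<open>
  The identity is the sum of the projections onto the vectors of an orthonormal basis; taking the
  trace inner product with \<open>X\<close> gives the formula.
\<close>

lemma trace_orthonormal_basis:
  fixes X :: "('n::finite) symmat"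
  assumes "pairwise orthogonal T" and "\<And>e. e \<in> T \<Longrightarrow> norm e = 1"
    and "finite T" and "span T = UNIV"
  shows "trace (mat_of X) = (\<Sum>e\<in>T. inner e (mat_of X *v e))"
proof -
  have id_eq: "id_symmat = (1 / 2) *\<^sub>R (\<Sum>e\<in>T. sym_outer e e)"
  proof -
    have "mat_of (id_symmat :: 'n symmat) *v x =
        mat_of ((1 / 2) *\<^sub>R (\<Sum>e\<in>T. sym_outer e e)) *v x" for x
    proof -
      have lin: "linear (\<lambda>X. mat_of X *v x)"
        by (rule linearI) (simp_all add: mat_of_vec_simps)
      have "mat_of (\<Sum>e\<in>T. sym_outer e e) *v x = (\<Sum>e\<in>T. mat_of (sym_outer e e) *v x)"
        by (rule linear_sum[OF lin])
      also have "\<dots> = 2 *\<^sub>R (\<Sum>e\<in>T. inner x e *\<^sub>R e)"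
        by (simp add: sym_outer_vec scaleR_sum_right inner_commute flip: scaleR_2)
      also have "(\<Sum>e\<in>T. inner x e *\<^sub>R e) = x"
        using assms by (intro orthonormal_basis_expand) auto
      finally show ?thesis
        by (simp add: mat_of_vec_simps)
    qed
    then show ?thesis
      by (simp add: matrix_eq flip: mat_of_inject)
  qed
  have "inner id_symmat X = (1 / 2) * (\<Sum>e\<in>T. inner (sym_outer e e) X)"
    by (subst id_eq) (simp add: inner_sum_left)
  also have "\<dots> = (\<Sum>e\<in>T. inner e (mat_of X *v e))"
    by (simp add: inner_sym_outer sum_distrib_left)
  finally show ?thesis
    by (simp add: inner_symmat_def id_symmat.rep_eq)
qed

lemma subspace_eigenspace: "subspace {x. mat_of X *v x = c *\<^sub>R x}"
  by (auto simp: subspace_def matrix_vector_right_distrib matrix_vector_mult_scaleR algebra_simps)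

text \<open>
  Compute the trace in an orthonormal basis made of one of \<open>W\<close> and one of its orthogonal complement.
  Each vector of the first contributes \<open>\<alpha>\<close>, those of the second contribute nonnegative amounts.
  If the latter are all zero, then \<open>X\<close> kills the whole complement, which is excluded by \<open>v\<close> in the
  second claim.
\<close>

lemma eigenspace_trace_bound:
  fixes X :: "('n::finite) symmat" and \<alpha> :: real
  defines "W \<equiv> {x. mat_of X *v x = \<alpha> *\<^sub>R x}"
  assumes "psd X"
  shows "\<alpha> * dim W \<le> trace (mat_of X)"
    and "\<lbrakk>\<And>w. w \<in> W \<Longrightarrow> orthogonal w v; mat_of X *v v \<noteq> 0\<rbrakk> \<Longrightarrow> \<alpha> * dim W < trace (mat_of X)"
proof -
  let ?q = "\<lambda>e. inner e (mat_of X *v e)"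
  define W' where "W' = {y. \<forall>x\<in>W. orthogonal x y}"
  have W: "subspace W"
    unfolding W_def by (rule subspace_eigenspace)
  have W': "subspace W'"
    unfolding W'_def by (rule subspace_orthogonal_to_vectors)
  obtain T where T: "T \<subseteq> W" "pairwise orthogonal T" "\<And>x. x \<in> T \<Longrightarrow> norm x = 1"
    "independent T" "card T = dim W" "span T = W"
    using orthonormal_basis_subspace[OF W] by metis
  obtain T' where T': "T' \<subseteq> W'" "pairwise orthogonal T'" "\<And>x. x \<in> T' \<Longrightarrow> norm x = 1"
    "independent T'" "span T' = W'"
    using orthonormal_basis_subspace[OF W'] by metis
  have fin: "finite T" "finite T'"
    using T T' independent_imp_finite by blast+
  have cross: "orthogonal x y" "orthogonal y x" if "x \<in> T" "y \<in> T'" for x y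
    using that T(1) T'(1) unfolding W'_def
    by (blast, metis (mono_tags) mem_Collect_eq orthogonal_commute subsetD)
  have disj: "T \<inter> T' = {}"
    using cross T(3) by (fastforce simp: orthogonal_self)
  have "span (T \<union> T') = UNIV"
  proof -
    have "x \<in> span (T \<union> T')" for x
    proof -
      obtain y z where yz: "y \<in> span W" "\<And>w. w \<in> span W \<Longrightarrow> orthogonal z w" "x = y + z"
        using orthogonal_subspace_decomp_exists[of W x] by blast
      have "y \<in> span T" "z \<in> span T'"
        using yz W by (auto simp: T(6) T'(5) W'_def span_base orthogonal_commute span_eq_iff[THEN iffD2])
      then show ?thesis
        unfolding yz(3) by (meson Un_upper1 Un_upper2 span_add span_mono subsetD)
    qed
    then show ?thesis
      by blast
  qed
  moreover have "pairwise orthogonal (T \<union> T')"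
    using T(2) T'(2) cross by (auto simp: pairwise_def)
  ultimately have "trace (mat_of X) = sum ?q (T \<union> T')"
    using T(3) T'(3) fin by (intro trace_orthonormal_basis) auto
  also have "\<dots> = sum ?q T + sum ?q T'"
    using fin disj by (rule sum.union_disjoint)
  also have "sum ?q T = (\<Sum>e\<in>T. \<alpha>)"
    using T(1,3) by (intro sum.cong) (auto simp: W_def norm_eq_1)
  also have "\<dots> = \<alpha> * dim W"
    by (simp add: T(5))
  finally have trace_eq: "trace (mat_of X) = \<alpha> * dim W + sum ?q T'" .
  have nonneg: "0 \<le> ?q e" for e
    using assms(2) by (simp add: psd_def)
  show "\<alpha> * dim W \<le> trace (mat_of X)"
    by (simp add: trace_eq sum_nonneg nonneg)
  show "\<alpha> * dim W < trace (mat_of X)"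
    if v: "\<And>w. w \<in> W \<Longrightarrow> orthogonal w v" "mat_of X *v v \<noteq> 0"
  proof -
    have "sum ?q T' \<noteq> 0"
    proof
      assume "sum ?q T' = 0"
      then have "mat_of X *v e = 0" if "e \<in> T'" for e
        using that fin(2) nonneg psd_kernel[OF assms(2)] by (simp add: sum_nonneg_eq_0_iff)
      moreover have "v \<in> span T'"
        using v(1) by (simp add: T'(5) W'_def)
      ultimately have "mat_of X *v v = 0"
        using linear_eq_0_on_span[OF matrix_vector_mul_linear] by blast
      with v(2) show False
        by contradiction
    qed
    then have "0 < sum ?q T'"
      using nonneg by (simp add: order.strict_iff_order sum_nonneg)
    then show ?thesis
      by (simp add: trace_eq)
  qed
qed

text \<open>
  The range of a symmetric matrix is orthogonal to its kernel \<open>U\<close>, so the rank is at most the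
  codimension of \<open>U\<close>. Requiring orthogonality to \<open>W\<close> as well costs at most \<open>dim W\<close> dimensions.
\<close>

lemma rank_le_dim_plus_complement:
  fixes X :: "('n::finite) symmat"
  defines "U \<equiv> {x. mat_of X *v x = 0}"
  assumes "subspace W"
  shows "rank (mat_of X) \<le> dim W + dim {y. \<forall>x\<in>U \<union> W. orthogonal x y}"
proof -
  let ?S = "{u + w |u w. u \<in> U \<and> w \<in> W}" and ?n = "DIM(real^'n)"
  have U: "subspace U"
    unfolding U_def by (rule linear_subspace_kernel[OF matrix_vector_mul_linear])
  have "range ((*v) (mat_of X)) \<subseteq> {y. \<forall>x\<in>U. orthogonal x y}"
    by (auto simp: U_def orthogonal_def inner_mat_of_commute)
  then have "rank (mat_of X) \<le> dim {y. \<forall>x\<in>U. orthogonal x y}"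
    unfolding rank_dim_range by (rule dim_subset)
  moreover have "dim {y. \<forall>x\<in>U. orthogonal x y} + dim U = ?n"
    using dim_subspace_orthogonal_to_vectors[OF U subspace_UNIV] by simp
  moreover have "dim {y. \<forall>x\<in>?S. orthogonal x y} + dim ?S = ?n"
    using dim_subspace_orthogonal_to_vectors[OF subspace_sums[OF U assms(2)] subspace_UNIV] by simp
  moreover have "dim ?S \<le> dim U + dim W"
    using dim_sums_Int[OF U assms(2)] by linarith
  moreover have "{y. \<forall>x\<in>?S. orthogonal x y} = {y. \<forall>x\<in>U \<union> W. orthogonal x y}"
  proof -
    have "U \<subseteq> ?S" "W \<subseteq> ?S"
      using subspace_0[OF U] subspace_0[OF assms(2)] by force+
    then show ?thesis
      by (auto simp: orthogonal_clauses) blast+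
  qed
  ultimately show ?thesis
    by simp
qed

section \<open>Extreme points and the rank bound\<close>

text \<open>
  \<open>V\<close> is spanned by the eigenvectors of \<open>X\<close> with eigenvalue strictly between \<open>0\<close> and \<open>\<alpha>\<close>. A
  perturbation acting only inside \<open>V\<close> vanishes on the kernels of both \<open>X\<close> and \<open>\<alpha> I - X\<close>, so in
  small multiples of either sign it preserves both semidefiniteness constraints. If these
  perturbations, of which there are \<open>dim V (dim V + 1) / 2\<close> independent ones, outnumber the linear
  equations, then a nonzero one preserves the equations too, and \<open>X\<close> lies inside a feasible segment.
\<close>

lemma extreme_point_dim_bound:
  fixes X :: "('n::finite) symmat" and B :: "'n symmat \<Rightarrow> real^('m::finite)" and \<alpha> :: real
  defines "V \<equiv> {v. \<forall>u\<in>{x. mat_of X *v x = 0} \<union> {x. mat_of X *v x = \<alpha> *\<^sub>R x}. orthogonal u v}"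
  assumes B: "linear B" and X: "X extreme_point_of {X. sdp_feasible B b \<alpha> X}"
  shows "dim V * (dim V + 1) \<le> 2 * CARD('m)"
proof (rule ccontr)
  assume large: "\<not> dim V * (dim V + 1) \<le> 2 * CARD('m)"
  let ?S = "{D :: 'n symmat. \<forall>x. (\<forall>v\<in>V. orthogonal v x) \<longrightarrow> mat_of D *v x = 0}"
  have V: "subspace V"
    unfolding V_def by (rule subspace_orthogonal_to_vectors)
  have "DIM(real^'m) < dim ?S"
    using dim_supported_symmat[OF V] large by simp
  moreover have "subspace ?S"
    by (auto simp: subspace_def mat_of_vec_simps zero_symmat.rep_eq)
  ultimately obtain D where D: "D \<in> ?S" "D \<noteq> 0" "B D = 0"
    using linear_kernel_in_subspace[OF B] by blast
  have feas: "B X = b" "psd X" "psd (\<alpha> *\<^sub>R id_symmat - X)"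
    using X by (auto simp: extreme_point_of_def sdp_feasible_def)
  have "mat_of D *v x = 0" if "mat_of X *v x = 0" for x
    using D(1) that by (auto simp: V_def orthogonal_commute)
  from psd_perturbation[OF feas(2) this] obtain t\<^sub>1 where
    t\<^sub>1: "t\<^sub>1 > 0" "\<And>s. \<bar>s\<bar> \<le> t\<^sub>1 \<Longrightarrow> psd (X + s *\<^sub>R D)"
    by blast
  have "mat_of D *v x = 0" if "mat_of (\<alpha> *\<^sub>R id_symmat - X) *v x = 0" for x
    using D(1) that by (auto simp: V_def orthogonal_commute mat_of_vec_simps)
  from psd_perturbation[OF feas(3) this] obtain t\<^sub>2 where
    t\<^sub>2: "t\<^sub>2 > 0" "\<And>s. \<bar>s\<bar> \<le> t\<^sub>2 \<Longrightarrow> psd (\<alpha> *\<^sub>R id_symmat - X + s *\<^sub>R D)"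
    by blast
  define t where "t = min t\<^sub>1 t\<^sub>2"
  have t: "t > 0"
    using t\<^sub>1(1) t\<^sub>2(1) by (simp add: t_def)
  have feas_pert: "sdp_feasible B b \<alpha> (X + s *\<^sub>R D)" if "\<bar>s\<bar> \<le> t" for s
  proof -
    have "B (X + s *\<^sub>R D) = b"
      using B D(3) feas(1) by (simp add: linear_add linear_scale)
    moreover have "\<alpha> *\<^sub>R id_symmat - (X + s *\<^sub>R D) = \<alpha> *\<^sub>R id_symmat - X + (- s) *\<^sub>R D"
      by simp
    ultimately show ?thesis
      using that t\<^sub>1(2)[of s] t\<^sub>2(2)[of "- s"] by (simp only: sdp_feasible_def t_def)
  qed
  have "X = midpoint (X + t *\<^sub>R D) (X + (- t) *\<^sub>R D)"
    by (simp add: midpoint_def flip: scaleR_2)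
  moreover have "X + t *\<^sub>R D \<noteq> X + (- t) *\<^sub>R D"
    using t D(2) by (simp add: eq_neg_iff_add_eq_0 flip: scaleR_2)
  ultimately have "X \<in> open_segment (X + t *\<^sub>R D) (X + (- t) *\<^sub>R D)"
    by (metis midpoint_in_open_segment)
  then show False
    using X feas_pert[of t] feas_pert[of "- t"] t by (auto simp: extreme_point_of_def)
qed

text \<open>
  By compactness the largest trace is attained, so that \<^const>\<open>Greatest\<close> denotes a genuine maximum.
\<close>

lemma trace_le_greatest:
  fixes B :: "('n::finite) symmat \<Rightarrow> real^('m::finite)"
  assumes "linear B" and "sdp_feasible B b \<alpha> X"
  shows "trace (mat_of X) \<le> (GREATEST t. \<exists>X. sdp_feasible B b \<alpha> X \<and> t = trace (mat_of X))"
proof -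
  have tr: "trace (mat_of X) = inner id_symmat X" for X :: "'n symmat"
    by (simp add: inner_symmat_def id_symmat.rep_eq)
  obtain Z where Z: "sdp_feasible B b \<alpha> Z"
    "\<And>Y. sdp_feasible B b \<alpha> Y \<Longrightarrow> trace (mat_of Y) \<le> trace (mat_of Z)"
    using continuous_attains_sup[OF compact_feasible[OF assms(1), of b \<alpha>] _
        continuous_on_inner[OF continuous_on_const continuous_on_id], of id_symmat] assms(2)
    unfolding tr by blast
  have "(GREATEST t. \<exists>X. sdp_feasible B b \<alpha> X \<and> t = trace (mat_of X)) = trace (mat_of Z)"
    using Z by (intro Greatest_equality) auto
  then show ?thesis
    using Z(2) assms(2) by simp
qed

theorem theorem2p1:
  fixes C :: "('n::finite) symmat"
    and B :: "'n symmat \<Rightarrow> real^('m::finite)"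
    and b :: "real^'m"
    and \<alpha> \<beta> :: real
  assumes "\<alpha> > 0"
    and "linear B"
    and "inj (adjoint B)"
    and "\<exists>X. sdp_feasible B b \<alpha> X"
    and "\<beta> = (GREATEST t. \<exists>X. sdp_feasible B b \<alpha> X \<and> t = trace (mat_of X))"
  shows "\<exists>X. is_arg_min (\<lambda>Y. inner C Y) (sdp_feasible B b \<alpha>) X \<and>
           real (rank (mat_of X)) \<le> real_of_int \<lceil>\<beta> / \<alpha>\<rceil> + sqrt (2 * real CARD('m)) - 1"
proof -
  obtain X where X: "X extreme_point_of {X. sdp_feasible B b \<alpha> X}"
    and opt: "\<And>Y. sdp_feasible B b \<alpha> Y \<Longrightarrow> inner C X \<le> inner C Y"
    using extreme_minimizer_exists[OF compact_feasible[OF assms(2)] convex_feasible[OF assms(2)]]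
      assms(4) by (metis empty_iff mem_Collect_eq)
  have feas: "sdp_feasible B b \<alpha> X"
    using X by (simp add: extreme_point_of_def)
  then have psd: "psd X"
    by (simp add: sdp_feasible_def)
  define W where "W = {x. mat_of X *v x = \<alpha> *\<^sub>R x}"
  define V where "V = {v. \<forall>u\<in>{x. mat_of X *v x = 0} \<union> W. orthogonal u v}"
  have rank: "rank (mat_of X) \<le> dim W + dim V"
    unfolding V_def W_def by (intro rank_le_dim_plus_complement subspace_eigenspace)
  have trace: "trace (mat_of X) \<le> \<beta>"
    using trace_le_greatest[OF assms(2) feas] assms(5) by simp
  have "real (dim W + dim V) \<le> real_of_int \<lceil>\<beta> / \<alpha>\<rceil> + sqrt (2 * real CARD('m)) - 1"
  proof (cases "dim V = 0")
    case True
    \<comment> \<open>Here \<open>dim W\<close> may equal \<open>\<beta> / \<alpha>\<close>, and \<open>sqrt (2 m) \<ge> 1\<close> makes up for the \<open>-1\<close>.\<close>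
    have "\<alpha> * dim W \<le> \<beta>"
      using eigenspace_trace_bound(1)[OF psd] trace unfolding W_def by (rule order_trans)
    then have "real (dim W) \<le> \<beta> / \<alpha>"
      using assms(1) by (simp add: field_simps)
    then have "real (dim W) \<le> real_of_int \<lceil>\<beta> / \<alpha>\<rceil>"
      by linarith
    moreover have "1 \<le> sqrt (2 * real CARD('m))"
      using zero_less_card_finite[where 'a = 'm]
      by (simp del: zero_less_card_finite)
    ultimately show ?thesis
      using True by linarith
  next
    case False
    then obtain v where v: "v \<in> V" "v \<noteq> 0"
      using dim_eq_0[of V] by auto
    have "mat_of X *v v \<noteq> 0"
      using v unfolding V_def by (metis (mono_tags, lifting) UnI1 mem_Collect_eq orthogonal_self)
    moreover have "orthogonal w v" if "w \<in> W" for w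
      using v(1) that unfolding V_def by blast
    ultimately have "\<alpha> * dim W < trace (mat_of X)"
      unfolding W_def by (intro eigenspace_trace_bound(2)[OF psd])
    then have "\<alpha> * dim W < \<beta>"
      using trace by linarith
    \<comment> \<open>Strictness is what yields the \<open>-1\<close>: an integer below \<open>\<beta> / \<alpha>\<close> is below its ceiling.\<close>
    then have "real (dim W) < \<beta> / \<alpha>"
      using assms(1) by (simp add: field_simps)
    then have "int (dim W) < \<lceil>\<beta> / \<alpha>\<rceil>"
      by (simp add: less_ceiling_iff)
    then have "real (dim W) \<le> real_of_int \<lceil>\<beta> / \<alpha>\<rceil> - 1"
      by linarith
    moreover have "real (dim V) \<le> sqrt (2 * real CARD('m))"
    proof (rule real_le_rsqrt)
      have "(dim V)\<^sup>2 \<le> 2 * CARD('m)"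
        using extreme_point_dim_bound[OF assms(2) X]
        unfolding V_def W_def by (simp add: power2_eq_square)
      then show "(real (dim V))\<^sup>2 \<le> 2 * real CARD('m)"
        by (metis of_nat_le_iff of_nat_mult of_nat_numeral of_nat_power)
    qed
    ultimately show ?thesis
      by simp
  qed
  moreover have "is_arg_min (\<lambda>Y. inner C Y) (sdp_feasible B b \<alpha>) X"
    using feas opt by (simp add: is_arg_min_linorder)
  ultimately show ?thesis
    using rank by (intro exI[of _ X]) linarith
qed

end
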